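(* Let $m_1,m_2,m_3>0$ and let $\pi=\pi^{rot}\circ\pi_{tr}:\mathbb{C}^3\to\mathbb{R}^3$ be the composition of the complex linear projection $\pi_{tr}:\mathbb{C}^3\to\mathbb{C}^2$ and the real quadratic homogeneous map $\pi^{rot}:\mathbb{C}^2\to\mathbb{R}^3$ defined in the context. Then shape space is homeomorphic to $\mathbb{R}^3$, and $\pi$ realizes the quotient map from the space $\mathbb{C}^3$ of located triangles to shape space; that is, $\pi$ induces a homeomorphism from shape space onto $\mathbb{R}^3$. Moreover, writing $\pi({\bf q})={\bf w}=(w_1,w_2,w_3)$: (A) Two triangles ${\bf q},{\bf q}'\in\mathbb{C}^3$ are oriented congruent if and only if $\pi({\bf q})=\pi({\bf q}')$. (B) $\pi$ is onto. (C) $\pi$ maps the triple collision locus $\{(q,q,q):q\in\mathbb{C}\}$ onto the origin. (D) There is a nonzero constant $\kappa$ depending only on the masses such that $w_3=\kappa\cdot(\text{signed area of the triangle }{\bf q})$ for all ${\bf q}\in\mathbb{C}^3$. (E) The locus of collinear triangles corresponds to the plane $w_3=0$: the vertices of ${\bf q}$ are collinear if and only if $w_3=0$. (F) Let $\sigma(w_1,w_2,w_3)=(w_1,w_2,-w_3)$. Two triangles ${\bf q},{\bf q}'\in\mathbb{C}^3$ are congruent if and only if $\pi({\bf q})=\pi({\bf q}')$ or $\pi({\bf q})=\sigma(\pi({\bf q}'))$. (G) If $m_1q_1+m_2q_2+m_3q_3=0$, then $w_1^2+w_2^2+w_3^2=\left(\tfrac12 I\right)^2$, where $I=m_1|q_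1|^2+m_2|q_2|^2+m_3|q_3|^2$.
   Context: A located triangle is a vector ${\bf q}=(q_1,q_2,q_3)\in\mathbb{C}^3$ whose components are the labelled vertices, in the plane $\mathbb{C}\cong\mathbb{R}^2$; degenerate triangles are allowed. The mass norm on $\mathbb{C}^3$ is $\|{\bf v}\|^2=m_1|v_1|^2+m_2|v_2|^2+m_3|v_3|^2$. Let $G$ be the group of rigid motions (orientation-preserving isometries) of the plane, acting on $\mathbb{C}^3$ vertexwise: translations act by ${\bf q}\mapsto{\bf q}+c(1,1,1)$, $c\in\mathbb{C}$, and rotations by ${\bf q}\mapsto e^{i\theta}{\bf q}$. Two located triangles are oriented congruent if some $g\in G$ takes one to the other, and congruent if some isometry of the plane (possibly orientation reversing), applied vertexwise, takes one to the other. Shape space is the set of oriented congruence classes $[{\bf q}]$ with the quotient metric $d([{\bf q}],[{\bf q}'])=\inf_{g,g'\in G}\|g{\bf q}-g'{\bf q}'\|$. The signed area of ${\bf q}$ is $\tfrac12\,\mathrm{Im}\big(\overline{(q_2-q_1)}\,(q_3-q_1)\big)$. The map $\pi_{tr}:\mathbb{C}^3\to\mathbb{C}^2$ is $\pi_{tr}({\bf q})=(Z_1,Z_2)$ with normalized Jacobi coordinates $$Z_1=\mu_1(q_1-q_2),\qquad Z_2=\mu_2\Big(q_3-\frac{m_1q_1+m_2q_2}{m_1+m_2}\Big),$$ where $\mu_1,\mu_2>0$, $\frac1{\mu_1^2}=\frac1{m_1}+\frac1{m_2}$, $\frac1{\mu_2^2}=\frac1{m_3}+\frac1{m_1+m_2}$.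 The map $\pi^{rot}:\mathbb{C}^2\to\mathbb{R}^3$ is $$\pi^{rot}(Z_1,Z_2)=\Big(\tfrac12(|Z_1|^2-|Z_2|^2),\ \mathrm{Re}(Z_1\bar Z_2),\ \mathrm{Im}(Z_1\bar Z_2)\Big).$$ *)

theory Defs
  imports "HOL-Analysis.Analysis"
begin

type_synonym triangle = "complex^3"

definition vertexwise :: "(complex \<Rightarrow> complex) \<Rightarrow> triangle \<Rightarrow> triangle" where
  "vertexwise f q = (\<chi> i. f (q $ i))"

definition plane_isometry :: "(complex \<Rightarrow> complex) \<Rightarrow> bool" where
  "plane_isometry f \<longleftrightarrow> (\<forall>x y. dist (f x) (f y) = dist x y)"

definition rigid_motions :: "(complex \<Rightarrow> complex) set" where
  "rigid_motions = {\<lambda>z. cis \<theta> * z + c | \<theta> c. True}"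

definition oriented_congruent :: "triangle \<Rightarrow> triangle \<Rightarrow> bool" where
  "oriented_congruent q q' \<longleftrightarrow> (\<exists>g\<in>rigid_motions. vertexwise g q = q')"

definition congruent_triangles :: "triangle \<Rightarrow> triangle \<Rightarrow> bool" where
  "congruent_triangles q q' \<longleftrightarrow> (\<exists>f. plane_isometry f \<and> vertexwise f q = q')"

definition signed_area :: "triangle \<Rightarrow> real" where
  "signed_area q = Im (cnj (q $ 2 - q $ 1) * (q $ 3 - q $ 1)) / 2"

definition triple_collisions :: "triangle set" where
  "triple_collisions = {vector [c, c, c] | c. True}"

definition mass_norm :: "real^3 \<Rightarrow> triangle \<Rightarrow> real" where
  "mass_norm m v =
     sqrt (m $ 1 * (cmod (v $ 1))\<^sup>2 + m $ 2 * (cmod (v $ 2))\<^sup>2 + m $ 3 * (cmod (v $ 3))\<^sup>2)"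

definition shape_rel :: "(triangle \<times> triangle) set" where
  "shape_rel = {(q, q'). oriented_congruent q q'}"

definition shape_class :: "triangle \<Rightarrow> triangle set" where
  "shape_class q = shape_rel `` {q}"

definition shape_space :: "triangle set set" where
  "shape_space = UNIV // shape_rel"

text \<open>
  A congruence class is the orbit of any of its members, so the infimum of
  \<open>mass_norm m (g q - g' q')\<close> over rigid motions \<open>g\<close>, \<open>g'\<close> ranges over the pairs of
  representatives; see \<open>shape_dist_shape_class\<close> below. The value 0 outside \<open>shape_space\<close> is
  a dummy: the locale \<open>Metric_space\<close> asks for nonnegativity and symmetry on the whole type,
  and the infimum of an empty set of reals is unspecified.
\<close>

definition shape_dist :: "real^3 \<Rightarrow> triangle set \<Rightarrow> triangle set \<Rightarrow> real" where
  "shape_dist m A B =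
     (if A \<in> shape_space \<and> B \<in> shape_space
      then INF (q, q') \<in> A \<times> B. mass_norm m (q - q') else 0)"

definition shape_topology :: "real^3 \<Rightarrow> triangle set topology" where
  "shape_topology m = Metric_space.mtopology shape_space (shape_dist m)"

lemma shape_class_in_shape_space: "shape_class q \<in> shape_space"
  by (simp add: shape_class_def shape_space_def quotientI)

lemma shape_class_orbit: "shape_class q = (\<lambda>g. vertexwise g q) ` rigid_motions"
  by (auto simp: shape_class_def shape_rel_def oriented_congruent_def)

lemma shape_dist_shape_class:
  "shape_dist m (shape_class q) (shape_class q') =
     (INF (g, g') \<in> rigid_motions \<times> rigid_motions.
        mass_norm m (vertexwise g q - vertexwise g' q'))"
proof -
  have "(\<lambda>(x, y). mass_norm m (x - y)) ` (shape_class q \<times> shape_class q') =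
        (\<lambda>(g, g'). mass_norm m (vertexwise g q - vertexwise g' q')) `
          (rigid_motions \<times> rigid_motions)"
    unfolding shape_class_orbit by (force simp: image_iff)
  then show ?thesis
    by (simp add: shape_dist_def shape_class_in_shape_space)
qed

definition \<mu>\<^sub>1 :: "real^3 \<Rightarrow> real" where
  "\<mu>\<^sub>1 m = 1 / sqrt (1 / m $ 1 + 1 / m $ 2)"

definition \<mu>\<^sub>2 :: "real^3 \<Rightarrow> real" where
  "\<mu>\<^sub>2 m = 1 / sqrt (1 / m $ 3 + 1 / (m $ 1 + m $ 2))"

lemma \<mu>\<^sub>1_characterization:
  assumes "m $ 1 > 0" "m $ 2 > 0"
  shows "\<mu>\<^sub>1 m > 0" "1 / (\<mu>\<^sub>1 m)\<^sup>2 = 1 / m $ 1 + 1 / m $ 2"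
  using assms by (simp_all add: \<mu>\<^sub>1_def power_divide add_pos_pos)

lemma \<mu>\<^sub>2_characterization:
  assumes "m $ 1 > 0" "m $ 2 > 0" "m $ 3 > 0"
  shows "\<mu>\<^sub>2 m > 0" "1 / (\<mu>\<^sub>2 m)\<^sup>2 = 1 / m $ 3 + 1 / (m $ 1 + m $ 2)"
  using assms by (simp_all add: \<mu>\<^sub>2_def power_divide add_pos_pos)

definition \<pi>_tr :: "real^3 \<Rightarrow> triangle \<Rightarrow> complex^2" where
  "\<pi>_tr m q = vector
     [of_real (\<mu>\<^sub>1 m) * (q $ 1 - q $ 2),
      of_real (\<mu>\<^sub>2 m) *
        (q $ 3 - (of_real (m $ 1) * q $ 1 + of_real (m $ 2) * q $ 2) / of_real (m $ 1 + m $ 2))]"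

definition \<pi>_rot :: "complex^2 \<Rightarrow> real^3" where
  "\<pi>_rot Z = vector
     [((cmod (Z $ 1))\<^sup>2 - (cmod (Z $ 2))\<^sup>2) / 2,
      Re (Z $ 1 * cnj (Z $ 2)),
      Im (Z $ 1 * cnj (Z $ 2))]"

definition shape_map :: "real^3 \<Rightarrow> triangle \<Rightarrow> real^3" where
  "shape_map m = \<pi>_rot \<circ> \<pi>_tr m"

definition reflect3 :: "real^3 \<Rightarrow> real^3" where
  "reflect3 w = vector [w $ 1, w $ 2, - w $ 3]"

end

theory Submission
  imports Defs
begin

text \<open>
  Jacobi coordinates together with the centre of mass split the squared mass norm of a triangle
  orthogonally into \<open>norm (\<pi>_tr m q)\<^sup>2\<close> and a term for the centre of mass (\<open>mass_norm_Jacobi\<close>).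
  A translation moves only the centre of mass, and a rotation multiplies both Jacobi coordinates by
  one phase. Shape space is therefore the quotient of \<open>complex^2\<close> by the circle, and \<open>\<pi>_rot\<close> is the
  Hopf map, extended from the unit sphere to all of \<open>complex^2\<close>.

  The distance between the circle orbits of \<open>Z\<close> and \<open>W\<close> is found by rotating \<open>W\<close> until the Hermitian
  product of \<open>Z\<close> and \<open>W\<close> is real and nonnegative: its square is the sum of the two squared norms
  minus twice the modulus of the product. Both ingredients can be read off from the images under
  \<open>\<pi>_rot\<close> (\<open>norm_Pi_rot\<close>, \<open>norm_Pi_rot_diff\<close>), so the quotient metric is an explicit function
  \<open>orbit_distance\<close> of two points of \<open>real^3\<close> (\<open>shape_dist_eq_orbit_distance\<close>), and the infimum in its
  definition is attained (\<open>orbit_distance_attained\<close>).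

  Most of the theorem follows from this formula. The function vanishes only on the diagonal, so
  triangles with the same image are oriented congruent. It is bounded above and below in terms of the
  Euclidean distance (\<open>orbit_distance_le\<close>, \<open>orbit_distance_ge\<close>), so the induced bijection onto
  \<open>real^3\<close> is a homeomorphism; and since nearby classes have nearby representatives, the shape map is
  open and hence a quotient map. Surjectivity comes from an explicit preimage under \<open>\<pi>_rot\<close>.

  The remaining claims are read off from coordinates. The third coordinate is the cross product of the
  Jacobi vectors, a multiple of the signed area. The other two and the norm depend only on inner
  products of sides, so isometric triangles have images that differ at most in the sign of the third
  coordinate, and conjugation realises that sign change. For centre of mass zero, the
  mass norm is the norm of its Jacobi coordinates, and \<open>\<pi>_rot\<close> sends norm \<open>r\<close> to norm \<open>r\<^sup>2 / 2\<close>.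
\<close>

section \<open>The Hopf map from pairs of complex numbers to space\<close>

definition hermitian :: "complex^2 \<Rightarrow> complex^2 \<Rightarrow> complex" where
  "hermitian Z W = Z $ 1 * cnj (W $ 1) + Z $ 2 * cnj (W $ 2)"

lemma norm_sq_complex2: "(norm (Z :: complex^2))\<^sup>2 = (cmod (Z $ 1))\<^sup>2 + (cmod (Z $ 2))\<^sup>2"
  by (simp add: norm_vec_def L2_set_def sum_2)

lemma norm_sq_real3: "(norm (w :: real^3))\<^sup>2 = (w $ 1)\<^sup>2 + (w $ 2)\<^sup>2 + (w $ 3)\<^sup>2"
  by (simp add: norm_vec_def L2_set_def sum_3)

lemma cmod_add_sq: "(cmod (a + b))\<^sup>2 = (cmod a)\<^sup>2 + (cmod b)\<^sup>2 + 2 * Re (a * cnj b)"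
  unfolding cmod_power2 by (simp add: power2_eq_square algebra_simps)

lemma norm_Pi_rot: "norm (\<pi>_rot Z) = (norm Z)\<^sup>2 / 2"
proof -
  define p q where "p = (cmod (Z $ 1))\<^sup>2" and "q = (cmod (Z $ 2))\<^sup>2"
  have "(norm (\<pi>_rot Z))\<^sup>2 = ((p - q) / 2)\<^sup>2 + (cmod (Z $ 1 * cnj (Z $ 2)))\<^sup>2"
    by (simp only: norm_sq_real3 \<pi>_rot_def vector_3 cmod_power2[of "Z $ 1 * _"] p_def q_def add.assoc)
  also have "\<dots> = ((p - q) / 2)\<^sup>2 + p * q"
    by (simp add: norm_mult power_mult_distrib p_def q_def)
  also have "\<dots> = ((p + q) / 2)\<^sup>2"
    by (simp add: power2_eq_square field_simps)
  finally have "(norm (\<pi>_rot Z))\<^sup>2 = ((norm Z)\<^sup>2 / 2)\<^sup>2"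
    by (simp add: norm_sq_complex2 p_def q_def)
  then show ?thesis by (simp add: power2_eq_iff_nonneg)
qed

text \<open>
  With \<open>\<alpha> = Z\<^sub>1 cnj Z\<^sub>2\<close> and \<open>\<beta> = W\<^sub>1 cnj W\<^sub>2\<close>, the same cross term \<open>2 * Re (\<alpha> cnj \<beta>)\<close> occurs
  in the squared distance of the images and in the squared modulus of the Hermitian product, with
  opposite signs, so their sum involves the norms only. Hence the images determine that modulus.
\<close>

lemma norm_Pi_rot_diff:
  "(norm (\<pi>_rot Z - \<pi>_rot W))\<^sup>2 =
     (norm (\<pi>_rot Z) + norm (\<pi>_rot W))\<^sup>2 - (cmod (hermitian Z W))\<^sup>2"
proof -
  define p q r t where "p = (cmod (Z $ 1))\<^sup>2" and "q = (cmod (Z $ 2))\<^sup>2"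
    and "r = (cmod (W $ 1))\<^sup>2" and "t = (cmod (W $ 2))\<^sup>2"
  define \<alpha> \<beta> where "\<alpha> = Z $ 1 * cnj (Z $ 2)" and "\<beta> = W $ 1 * cnj (W $ 2)"
  have ab: "(cmod \<alpha>)\<^sup>2 = p * q" "(cmod \<beta>)\<^sup>2 = r * t"
    by (simp_all add: \<alpha>_def \<beta>_def p_def q_def r_def t_def norm_mult power_mult_distrib)
  have "(norm (\<pi>_rot Z - \<pi>_rot W))\<^sup>2 = ((p - q) / 2 - (r - t) / 2)\<^sup>2 + (cmod (\<alpha> - \<beta>))\<^sup>2"
    unfolding norm_sq_real3 cmod_power2[of "\<alpha> - \<beta>"]
    by (simp only: \<pi>_rot_def vector_minus_component vector_3
         minus_complex.sel p_def q_def r_def t_def \<alpha>_def \<beta>_def add.assoc)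
  also have "(cmod (\<alpha> - \<beta>))\<^sup>2 = p * q + r * t - 2 * Re (\<alpha> * cnj \<beta>)"
    using cmod_add_sq[of \<alpha> "- \<beta>"] by (simp add: ab)
  finally have lhs: "(norm (\<pi>_rot Z - \<pi>_rot W))\<^sup>2 =
      ((p - q) / 2 - (r - t) / 2)\<^sup>2 + (p * q + r * t - 2 * Re (\<alpha> * cnj \<beta>))" .
  have "Z $ 1 * cnj (W $ 1) * cnj (Z $ 2 * cnj (W $ 2)) = \<alpha> * cnj \<beta>"
    by (simp add: \<alpha>_def \<beta>_def)
  then have "(cmod (hermitian Z W))\<^sup>2 = p * r + q * t + 2 * Re (\<alpha> * cnj \<beta>)"
    unfolding hermitian_def cmod_add_sq
    by (simp only: norm_mult power_mult_distrib complex_mod_cnj p_def q_def r_def t_def)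
  then show ?thesis
    unfolding lhs norm_Pi_rot norm_sq_complex2 p_def[symmetric] q_def[symmetric]
      r_def[symmetric] t_def[symmetric]
    by (simp add: power2_eq_square field_simps)
qed

lemma norm_diff_sq: "(norm (Z - W))\<^sup>2 = (norm Z)\<^sup>2 + (norm W)\<^sup>2 - 2 * Re (hermitian Z W)"
  using cmod_add_sq[of "Z $ 1" "- W $ 1"] cmod_add_sq[of "Z $ 2" "- W $ 2"]
  by (simp add: norm_sq_complex2 hermitian_def)

text \<open>
  The distance between two circle orbits in \<open>complex^2\<close> (equivalently, between two oriented
  congruence classes), as a function of their images \<open>w\<close> and \<open>w'\<close>: the squared norms of the two
  points are \<open>2 * norm w\<close> and \<open>2 * norm w'\<close>, and the inner square root is the modulus of their
  Hermitian product, by \<open>norm_Pi_rot\<close> and \<open>norm_Pi_rot_diff\<close>.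
\<close>

definition orbit_distance :: "real^3 \<Rightarrow> real^3 \<Rightarrow> real" where
  "orbit_distance w w' = sqrt (2 * (norm w + norm w'
      - sqrt ((norm w + norm w')\<^sup>2 - (norm (w - w'))\<^sup>2)))"

lemma orbit_distance_radicand:
  "0 \<le> (norm w + norm w')\<^sup>2 - (norm (w - w'))\<^sup>2"
  "sqrt ((norm w + norm w')\<^sup>2 - (norm (w - w'))\<^sup>2) \<le> norm w + norm w'"
  by (simp_all add: power_mono norm_triangle_ineq4 real_le_lsqrt)

lemma orbit_distance_nonneg: "orbit_distance w w' \<ge> 0" and
  orbit_distance_sq: "(orbit_distance w w')\<^sup>2 =
     2 * (norm w + norm w' - sqrt ((norm w + norm w')\<^sup>2 - (norm (w - w'))\<^sup>2))"
  using orbit_distance_radicand[of w w'] by (simp_all add: orbit_distance_def)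

lemma orbit_distance_commute: "orbit_distance w w' = orbit_distance w' w"
  by (simp add: orbit_distance_def norm_minus_commute add.commute)

text \<open>
  This bound and the next one compare the orbit distance with the Euclidean distance. Write \<open>s\<close> for
  \<open>norm w + norm w'\<close>, \<open>x\<close> for \<open>norm (w - w')\<close> and \<open>t\<close> for the root of \<open>s\<^sup>2 - x\<^sup>2\<close>. The squared orbit
  distance is \<open>2 * (s - t)\<close>, and \<open>t \<ge> s - x\<close> because \<open>x \<le> s\<close>.
\<close>

lemma orbit_distance_le: "(orbit_distance w w')\<^sup>2 \<le> 2 * norm (w - w')"
proof -
  let ?s = "norm w + norm w'" and ?x = "norm (w - w')"
  have le: "?x \<le> ?s" by (rule norm_triangle_ineq4)
  have "(?s - ?x)\<^sup>2 \<le> ?s\<^sup>2 - ?x\<^sup>2"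
    using mult_left_mono[of "?s - ?x" "?s + ?x" "?s - ?x"] le
    by (simp add: power2_eq_square algebra_simps)
  then have "?s - ?x \<le> sqrt (?s\<^sup>2 - ?x\<^sup>2)" by (rule real_le_rsqrt)
  then show ?thesis unfolding orbit_distance_sq by simp
qed

text \<open>
  Conversely \<open>x\<^sup>2 = (s - t) * (s + t)\<close>, and \<open>t \<le> s\<close>. The factor \<open>norm w + norm w'\<close> cannot be
  replaced by a constant: the orbit distance scales like the square root of the Euclidean distance.
\<close>

lemma orbit_distance_ge: "(norm (w - w'))\<^sup>2 \<le> (orbit_distance w w')\<^sup>2 * (norm w + norm w')"
proof -
  define s x t where "s = norm w + norm w'" and "x = norm (w - w')" and "t = sqrt (s\<^sup>2 - x\<^sup>2)"
  have t: "t\<^sup>2 = s\<^sup>2 - x\<^sup>2" "0 \<le> t" "t \<le> s"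
    using orbit_distance_radicand[of w w'] by (simp_all add: s_def x_def t_def)
  have "x\<^sup>2 = (s - t) * (s + t)"
    using t(1) by (simp add: power2_eq_square algebra_simps)
  also have "\<dots> \<le> (s - t) * (2 * s)"
    using t by (intro mult_left_mono) auto
  finally show ?thesis
    by (simp add: orbit_distance_sq algebra_simps flip: s_def x_def t_def)
qed

lemma orbit_distance_eq_0_iff: "orbit_distance w w' = 0 \<longleftrightarrow> w = w'"
  using orbit_distance_ge[of w w'] orbit_distance_le[of w w'] by auto

lemma orbit_distance_Pi_rot:
  "(orbit_distance (\<pi>_rot Z) (\<pi>_rot W))\<^sup>2 = (norm Z)\<^sup>2 + (norm W)\<^sup>2 - 2 * cmod (hermitian Z W)"
  unfolding orbit_distance_sq norm_Pi_rot_diff by (simp add: norm_Pi_rot)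

lemma orbit_distance_le_norm_diff: "orbit_distance (\<pi>_rot Z) (\<pi>_rot W) \<le> norm (Z - W)"
proof (rule power2_le_imp_le)
  show "(orbit_distance (\<pi>_rot Z) (\<pi>_rot W))\<^sup>2 \<le> (norm (Z - W))\<^sup>2"
    unfolding orbit_distance_Pi_rot norm_diff_sq
    using complex_Re_le_cmod[of "hermitian Z W"] by linarith
qed simp

lemma Pi_rot_rotate: "\<pi>_rot (\<chi> i. cis \<theta> * Z $ i) = \<pi>_rot Z"
proof -
  have "cis \<theta> * a * cnj (cis \<theta> * b) = (cis \<theta> * cnj (cis \<theta>)) * (a * cnj b)" for a b
    by (simp only: complex_cnj_mult ac_simps)
  moreover have "cis \<theta> * cnj (cis \<theta>) = 1"
    by (simp add: cis_cnj cis_mult)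
  ultimately have "cis \<theta> * a * cnj (cis \<theta> * b) = a * cnj b" for a b
    by (simp only: mult_1)
  then show ?thesis
    by (simp only: \<pi>_rot_def vec_lambda_beta norm_mult norm_cis mult_1)
qed

text \<open>
  Only the real part of the Hermitian product enters the distance of two points, so the best
  rotation of \<open>W\<close> is the one that makes this product real and nonnegative.
\<close>

lemma rotation_attaining_orbit_distance:
  obtains \<theta> where "norm (Z - (\<chi> i. cis \<theta> * W $ i)) = orbit_distance (\<pi>_rot Z) (\<pi>_rot W)"
proof
  define h where "h = hermitian Z W"
  let ?W = "\<chi> i. cis (Arg h) * W $ i"
  have "hermitian Z ?W = cnj (cis (Arg h)) * h"
    by (simp add: hermitian_def h_def algebra_simps)
  also have "\<dots> = cnj (cis (Arg h)) * (cis (Arg h) * of_real (cmod h))"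
    by (metis rcis_cmod_Arg rcis_def mult.commute)
  also have "\<dots> = of_real (cmod h)"
    by (simp add: cis_cnj cis_mult flip: mult.assoc)
  finally have "hermitian Z ?W = of_real (cmod h)" .
  moreover have "norm ?W = norm W"
    using norm_Pi_rot[of ?W] norm_Pi_rot[of W] by (simp add: Pi_rot_rotate power2_eq_iff_nonneg)
  ultimately have "(norm (Z - ?W))\<^sup>2 = (orbit_distance (\<pi>_rot Z) (\<pi>_rot W))\<^sup>2"
    by (simp add: orbit_distance_Pi_rot norm_diff_sq h_def)
  then show "norm (Z - ?W) = orbit_distance (\<pi>_rot Z) (\<pi>_rot W)"
    by (simp add: power2_eq_iff_nonneg orbit_distance_nonneg)
qed

text \<open>
  A preimage can be normalised to have a nonnegative real first coordinate, whose square must be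
  \<open>norm w + w $ 1\<close>; the product \<open>Z\<^sub>1 cnj Z\<^sub>2\<close> then gives the second coordinate. On the ray where
  \<open>norm w + w $ 1\<close> vanishes, the first coordinate is zero and only the norm of the second matters.
\<close>

lemma surj_Pi_rot: "surj \<pi>_rot"
  unfolding surj_def
proof
  fix w :: "real^3"
  have n: "(norm w)\<^sup>2 = (w $ 1)\<^sup>2 + (w $ 2)\<^sup>2 + (w $ 3)\<^sup>2" by (rule norm_sq_real3)
  show "\<exists>Z. w = \<pi>_rot Z"
  proof (cases "norm w + w $ 1 = 0")
    case True
    then have "w $ 1 = - norm w" by simp
    with n have "w $ 2 = 0 \<and> w $ 3 = 0" by (simp add: sum_power2_eq_zero_iff)
    with True have "w = \<pi>_rot (vector [0, of_real (sqrt (2 * norm w))])"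
      by (simp add: \<pi>_rot_def vec_eq_iff forall_3)
    then show ?thesis ..
  next
    case False
    define a where "a = norm w + w $ 1"
    have a: "a > 0" using False component_le_norm_cart[of w 1] by (simp add: a_def)
    define Z :: "complex^2" where
      "Z = vector [of_real (sqrt a), Complex (w $ 2) (- w $ 3) / of_real (sqrt a)]"
    have "(w $ 2)\<^sup>2 + (w $ 3)\<^sup>2 = a * (norm w - w $ 1)"
      using n by (simp add: a_def power2_eq_square algebra_simps)
    then have "(cmod (Complex (w $ 2) (- w $ 3)))\<^sup>2 / a = norm w - w $ 1"
      using a by (simp add: cmod_power2)
    then have "((cmod (Z $ 1))\<^sup>2 - (cmod (Z $ 2))\<^sup>2) / 2 = w $ 1"
      using a by (simp add: Z_def norm_divide power_divide) (simp add: a_def)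
    moreover have "Z $ 1 * cnj (Z $ 2) = Complex (w $ 2) (w $ 3)"
      using a by (simp add: Z_def complex_eq_iff)
    ultimately have "w = \<pi>_rot Z"
      by (simp add: \<pi>_rot_def vec_eq_iff forall_3)
    then show ?thesis ..
  qed
qed

section \<open>Congruence and collinearity of triangles\<close>

lemma vertexwise_comp: "vertexwise f (vertexwise g q) = vertexwise (f \<circ> g) q"
  by (simp add: vertexwise_def)

lemma equiv_shape_rel: "equiv UNIV shape_rel"
proof (rule equivI)
  have "(\<lambda>z. z) \<in> rigid_motions"
    by (auto simp: rigid_motions_def intro!: exI[of _ 0])
  then show "refl shape_rel"
    by (force simp: refl_on_def shape_rel_def oriented_congruent_def vertexwise_def)
  show "sym shape_rel"
  proof (rule symI)
    fix q q' assume "(q, q') \<in> shape_rel"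
    then obtain \<theta> c where q': "q' = vertexwise (\<lambda>z. cis \<theta> * z + c) q"
      by (auto simp: shape_rel_def oriented_congruent_def rigid_motions_def)
    have "vertexwise (\<lambda>z. cis (-\<theta>) * z + (- cis (-\<theta>) * c)) q' = q"
      unfolding q' vertexwise_def
      by (simp add: vec_eq_iff algebra_simps cis_mult flip: mult.assoc)
    then show "(q', q) \<in> shape_rel"
      unfolding shape_rel_def oriented_congruent_def rigid_motions_def by blast
  qed
  show "trans shape_rel"
  proof (rule transI)
    fix q q' q'' assume "(q, q') \<in> shape_rel" "(q', q'') \<in> shape_rel"
    then obtain \<theta> c \<phi> d where "q' = vertexwise (\<lambda>z. cis \<theta> * z + c) q"
      "q'' = vertexwise (\<lambda>z. cis \<phi> * z + d) q'"
      by (auto simp: shape_rel_def oriented_congruent_def rigid_motions_def)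
    then have "q'' = vertexwise (\<lambda>z. cis (\<phi> + \<theta>) * z + (cis \<phi> * c + d)) q"
      by (simp add: vertexwise_def algebra_simps flip: cis_mult)
    then show "(q, q'') \<in> shape_rel"
      unfolding shape_rel_def oriented_congruent_def rigid_motions_def by blast
  qed
qed simp

lemma collinear_iff_signed_area:
  "collinear {q $ 1, q $ 2, q $ 3} \<longleftrightarrow> signed_area q = 0"
proof -
  define u v where "u = q $ 2 - q $ 1" and "v = q $ 3 - q $ 1"
  have "collinear {q $ 1, q $ 2, q $ 3} \<longleftrightarrow> collinear {q $ 2, q $ 1, q $ 3}"
    by (simp add: insert_commute)
  \<comment> \<open>For \<open>u = 0\<close> the quotient is \<open>0\<close>, in agreement with the fact that two points are collinear.\<close>
  also have "\<dots> \<longleftrightarrow> v / u \<in> \<real>"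
    by (simp add: collinear_3 collinear_iff_Reals u_def v_def)
  also have "v / u = cnj u * v / of_real ((cmod u)\<^sup>2)"
    by (simp add: complex_div_cnj[of v u] mult.commute)
  also have "\<dots> \<in> \<real> \<longleftrightarrow> Im (cnj u * v) = 0"
    by (cases "u = 0") (simp_all add: complex_is_Real_iff)
  finally show ?thesis by (simp add: signed_area_def u_def v_def)
qed

section \<open>Jacobi coordinates and the mass norm\<close>

text \<open>
  The real identity behind Jacobi coordinates: first the two points \<open>x\<close>, \<open>y\<close> are replaced
  by their difference and their weighted mean, then the mean and \<open>z\<close> are. Each replacement splits
  a weighted sum of squares into a reduced-mass term and a term for the combined mass.
\<close>

lemma weighted_square_decomposition:
  fixes a b c x y z :: real
  assumes "a > 0" "b > 0" "c > 0"
  shows "a * x\<^sup>2 + b * y\<^sup>2 + c * z\<^sup>2 =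
    (a * b / (a + b)) * (x - y)\<^sup>2
    + (c * (a + b) / (a + b + c)) * (z - (a * x + b * y) / (a + b))\<^sup>2
    + (a * x + b * y + c * z)\<^sup>2 / (a + b + c)"
proof -
  define s t where "s = a + b" and "t = a + b + c"
  have st: "s \<noteq> 0" "t \<noteq> 0" using assms by (auto simp: s_def t_def)
  have cleared: "s * t * (a * x\<^sup>2 + b * y\<^sup>2 + c * z\<^sup>2) =
     t * a * b * (x - y)\<^sup>2 + c * (s * z - (a * x + b * y))\<^sup>2 + s * (a * x + b * y + c * z)\<^sup>2"
    unfolding s_def t_def by algebra
  have square: "(z - (a * x + b * y) / s)\<^sup>2 = (s * z - (a * x + b * y))\<^sup>2 / s\<^sup>2"
    using st by (simp add: diff_divide_distrib flip: power_divide)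
  have "a * x\<^sup>2 + b * y\<^sup>2 + c * z\<^sup>2 =
     (t * a * b * (x - y)\<^sup>2 + c * (s * z - (a * x + b * y))\<^sup>2
        + s * (a * x + b * y + c * z)\<^sup>2) / (s * t)"
    unfolding cleared[symmetric] using st by simp
  also have "\<dots> = a * b / s * (x - y)\<^sup>2 + c * s / t * (z - (a * x + b * y) / s)\<^sup>2
      + (a * x + b * y + c * z)\<^sup>2 / t"
    unfolding square using st by (simp add: add_divide_distrib power2_eq_square[of s] mult_ac)
  finally show ?thesis
    unfolding s_def t_def .
qed

definition center_of_mass :: "real^3 \<Rightarrow> triangle \<Rightarrow> complex" where
  "center_of_mass m q =
     (of_real (m $ 1) * q $ 1 + of_real (m $ 2) * q $ 2 + of_real (m $ 3) * q $ 3)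
       / of_real (m $ 1 + m $ 2 + m $ 3)"

lemma Pi_tr_diff: "\<pi>_tr m (q - q') = \<pi>_tr m q - \<pi>_tr m q'"
  by (simp add: vec_eq_iff forall_2 \<pi>_tr_def diff_divide_distrib add_divide_distrib algebra_simps)

lemma center_of_mass_diff: "center_of_mass m (q - q') = center_of_mass m q - center_of_mass m q'"
  by (simp add: center_of_mass_def algebra_simps diff_divide_distrib add_divide_distrib)

locale positive_masses =
  fixes m :: "real^3"
  assumes mass_pos: "m $ 1 > 0" "m $ 2 > 0" "m $ 3 > 0"
begin

lemma mass_sum_nonzero:
  "complex_of_real (m $ 1) + complex_of_real (m $ 2) \<noteq> 0"
  "complex_of_real (m $ 1) + complex_of_real (m $ 2) + complex_of_real (m $ 3) \<noteq> 0"
  using mass_pos by (simp_all flip: of_real_add)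

lemma \<mu>\<^sub>1_sq: "(\<mu>\<^sub>1 m)\<^sup>2 = m $ 1 * m $ 2 / (m $ 1 + m $ 2)"
  using mass_pos by (simp add: \<mu>\<^sub>1_def power_divide field_simps add_pos_pos)

lemma \<mu>\<^sub>2_sq: "(\<mu>\<^sub>2 m)\<^sup>2 = m $ 3 * (m $ 1 + m $ 2) / (m $ 1 + m $ 2 + m $ 3)"
  using mass_pos by (simp add: \<mu>\<^sub>2_def power_divide field_simps add_pos_pos)

lemma mass_norm_sq:
  "(mass_norm m v)\<^sup>2 =
     m $ 1 * (cmod (v $ 1))\<^sup>2 + m $ 2 * (cmod (v $ 2))\<^sup>2 + m $ 3 * (cmod (v $ 3))\<^sup>2"
  using mass_pos by (simp add: mass_norm_def)

text \<open>
  Once the centre of mass is scaled by the square root of the total mass, it forms together with the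
  Jacobi coordinates a unitary coordinate system for the mass norm. This is what fixes the values of
  \<open>\<mu>\<^sub>1\<close> and \<open>\<mu>\<^sub>2\<close>: their squares are the two reduced masses.
\<close>

lemma mass_norm_Jacobi:
  "(mass_norm m q)\<^sup>2 =
     (norm (\<pi>_tr m q))\<^sup>2 + (m $ 1 + m $ 2 + m $ 3) * (cmod (center_of_mass m q))\<^sup>2"
proof -
  define M where "M = m $ 1 + m $ 2 + m $ 3"
  define s where "s = m $ 1 + m $ 2"
  have M: "M > 0" "s > 0" using mass_pos by (simp_all add: M_def s_def)
  have "M * (cmod (center_of_mass m q))\<^sup>2 =
     (m $ 1 * Re (q $ 1) + m $ 2 * Re (q $ 2) + m $ 3 * Re (q $ 3))\<^sup>2 / M
     + (m $ 1 * Im (q $ 1) + m $ 2 * Im (q $ 2) + m $ 3 * Im (q $ 3))\<^sup>2 / M"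
  proof -
    define N where "N = of_real (m $ 1) * q $ 1 + of_real (m $ 2) * q $ 2 + of_real (m $ 3) * q $ 3"
    have "M * (cmod (center_of_mass m q))\<^sup>2 = M * ((cmod N)\<^sup>2 / M\<^sup>2)"
      by (simp only: center_of_mass_def norm_divide power_divide norm_of_real power2_abs N_def M_def)
    also have "\<dots> = (Re N)\<^sup>2 / M + (Im N)\<^sup>2 / M"
      unfolding cmod_power2 using M by (simp add: power2_eq_square[of M] add_divide_distrib distrib_left)
    finally show ?thesis by (simp add: N_def)
  qed
  moreover have "(norm (\<pi>_tr m q))\<^sup>2 =
     (\<mu>\<^sub>1 m)\<^sup>2 * ((Re (q $ 1) - Re (q $ 2))\<^sup>2 + (Im (q $ 1) - Im (q $ 2))\<^sup>2)
     + (\<mu>\<^sub>2 m)\<^sup>2 * ((Re (q $ 3) - (m $ 1 * Re (q $ 1) + m $ 2 * Re (q $ 2)) / s)\<^sup>2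
        + (Im (q $ 3) - (m $ 1 * Im (q $ 1) + m $ 2 * Im (q $ 2)) / s)\<^sup>2)"
    by (simp only: norm_sq_complex2 \<pi>_tr_def vector_2 norm_mult power_mult_distrib
       norm_of_real power2_abs cmod_power2 s_def[symmetric]) simp
  moreover have "(mass_norm m q)\<^sup>2 =
     (m $ 1 * (Re (q $ 1))\<^sup>2 + m $ 2 * (Re (q $ 2))\<^sup>2 + m $ 3 * (Re (q $ 3))\<^sup>2)
     + (m $ 1 * (Im (q $ 1))\<^sup>2 + m $ 2 * (Im (q $ 2))\<^sup>2 + m $ 3 * (Im (q $ 3))\<^sup>2)"
    unfolding mass_norm_sq cmod_power2 by (simp add: algebra_simps)
  ultimately show ?thesis
    unfolding weighted_square_decomposition[OF mass_pos] \<mu>\<^sub>1_sq \<mu>\<^sub>2_sq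
    unfolding M_def[symmetric] unfolding s_def[symmetric] unfolding distrib_left
    by linarith
qed

lemma mass_norm_nonneg: "mass_norm m v \<ge> 0"
  using mass_pos by (simp add: mass_norm_def)

lemma mass_norm_triangle: "mass_norm m (u + v) \<le> mass_norm m u + mass_norm m v"
proof -
  define W where "W v = (\<chi> i. of_real (sqrt (m $ i)) * v $ i)" for v :: triangle
  have "mass_norm m v = norm (W v)" for v
    using mass_pos
    by (simp add: W_def mass_norm_def norm_vec_def L2_set_def sum_3 norm_mult power_mult_distrib)
  moreover have "W (u + v) = W u + W v"
    by (simp add: W_def vec_eq_iff algebra_simps)
  ultimately show ?thesis using norm_triangle_ineq[of "W u" "W v"] by simp
qed

text \<open>
  Every Euclidean neighbourhood contains a mass-norm ball. This carries the distances between
  representatives, measured in the mass norm, over to the standard topology of \<open>complex^3\<close>.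
\<close>

lemma mass_norm_dominates_norm:
  obtains k where "k > 0" "\<And>v. norm v \<le> k * mass_norm m v"
proof -
  define \<mu> where "\<mu> = min (m $ 1) (min (m $ 2) (m $ 3))"
  have \<mu>: "\<mu> > 0" "\<mu> \<le> m $ 1" "\<mu> \<le> m $ 2" "\<mu> \<le> m $ 3"
    using mass_pos by (auto simp: \<mu>_def)
  have "norm v \<le> 1 / sqrt \<mu> * mass_norm m v" for v
  proof -
    have "\<mu> * (norm v)\<^sup>2 =
        \<mu> * (cmod (v $ 1))\<^sup>2 + \<mu> * (cmod (v $ 2))\<^sup>2 + \<mu> * (cmod (v $ 3))\<^sup>2"
      by (simp add: norm_vec_def L2_set_def sum_3 distrib_left)
    also have "\<dots> \<le> (mass_norm m v)\<^sup>2"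
      unfolding mass_norm_sq using \<mu> by (intro add_mono mult_right_mono) auto
    finally have "(sqrt \<mu> * norm v)\<^sup>2 \<le> (mass_norm m v)\<^sup>2"
      using \<mu> by (simp add: power_mult_distrib)
    then have "sqrt \<mu> * norm v \<le> mass_norm m v"
      using mass_norm_nonneg by (rule power2_le_imp_le)
    then show ?thesis using \<mu> by (simp add: field_simps)
  qed
  with \<mu> show thesis by (intro that[of "1 / sqrt \<mu>"]) auto
qed

lemma mass_norm_zero: "mass_norm m v = 0 \<longleftrightarrow> v = 0"
proof
  obtain k where "norm v \<le> k * mass_norm m v"
    using mass_norm_dominates_norm by blast
  then show "v = 0" if "mass_norm m v = 0" using that by simp
qed (simp add: mass_norm_def)

lemma Pi_tr_affine: "\<pi>_tr m (vertexwise (\<lambda>z. a * z + c) q) = (\<chi> i. a * \<pi>_tr m q $ i)"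
  using mass_sum_nonzero
  by (simp add: vec_eq_iff forall_2 \<pi>_tr_def vertexwise_def field_simps)

lemma center_of_mass_affine:
  "center_of_mass m (vertexwise (\<lambda>z. a * z + c) q) = a * center_of_mass m q + c"
  using mass_sum_nonzero
  by (simp add: center_of_mass_def vertexwise_def field_simps)

section \<open>The quotient metric in closed form\<close>

lemma shape_map_invariant:
  assumes "oriented_congruent q q'" shows "shape_map m q = shape_map m q'"
  using assms
  by (auto simp: oriented_congruent_def rigid_motions_def shape_map_def Pi_tr_affine Pi_rot_rotate)

lemma orbit_distance_le_mass_norm:
  "orbit_distance (shape_map m q) (shape_map m q') \<le> mass_norm m (q - q')"
proof -
  have "norm (\<pi>_tr m (q - q')) \<le> mass_norm m (q - q')"
  proof (rule power2_le_imp_le)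
    show "(norm (\<pi>_tr m (q - q')))\<^sup>2 \<le> (mass_norm m (q - q'))\<^sup>2"
      unfolding mass_norm_Jacobi using mass_pos by simp
  qed (rule mass_norm_nonneg)
  then show ?thesis
    using orbit_distance_le_norm_diff[of "\<pi>_tr m q" "\<pi>_tr m q'"]
    by (simp add: shape_map_def Pi_tr_diff)
qed

text \<open>
  The infimum that defines the quotient metric is attained: rotate optimally in Jacobi
  coordinates, which leaves the centre of mass free, and then translate to make the centres of mass
  coincide. Existence of a minimiser makes the separation of orbits and the triangle inequality
  immediate, and it is what makes the shape map open.
\<close>

lemma orbit_distance_attained:
  obtains q'' where "oriented_congruent q' q''"
    "mass_norm m (q - q'') = orbit_distance (shape_map m q) (shape_map m q')"
proof -
  obtain \<theta> where \<theta>: "norm (\<pi>_tr m q - (\<chi> i. cis \<theta> * \<pi>_tr m q' $ i)) =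
      orbit_distance (shape_map m q) (shape_map m q')"
    unfolding shape_map_def comp_apply by (rule rotation_attaining_orbit_distance)
  define c where "c = center_of_mass m q - cis \<theta> * center_of_mass m q'"
  define q'' where "q'' = vertexwise (\<lambda>z. cis \<theta> * z + c) q'"
  have "(mass_norm m (q - q''))\<^sup>2 = (orbit_distance (shape_map m q) (shape_map m q'))\<^sup>2"
    unfolding mass_norm_Jacobi Pi_tr_diff center_of_mass_diff
    by (simp add: q''_def Pi_tr_affine center_of_mass_affine \<theta>) (simp add: c_def)
  then have "mass_norm m (q - q'') = orbit_distance (shape_map m q) (shape_map m q')"
    by (simp add: power2_eq_iff_nonneg orbit_distance_nonneg mass_norm_nonneg)
  moreover have "oriented_congruent q' q''"
    unfolding q''_def oriented_congruent_def rigid_motions_def by blast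
  ultimately show thesis by (rule that[rotated])
qed

text \<open>
  If the images agree, then the orbit distance is zero. Since it is attained, some triangle
  congruent to the first is at distance zero from the second, hence equal to it.
\<close>

lemma oriented_congruent_iff: "oriented_congruent q q' \<longleftrightarrow> shape_map m q = shape_map m q'"
proof
  assume eq: "shape_map m q = shape_map m q'"
  obtain q'' where "oriented_congruent q q''" "mass_norm m (q' - q'') = 0"
    using orbit_distance_attained[of q q'] eq orbit_distance_eq_0_iff by metis
  then show "oriented_congruent q q'" by (simp add: mass_norm_zero)
qed (rule shape_map_invariant)

lemma shape_class_eq_iff: "shape_class q = shape_class q' \<longleftrightarrow> shape_map m q = shape_map m q'"
  using eq_equiv_class_iff[OF equiv_shape_rel, of q q']
  by (simp add: shape_class_def shape_rel_def oriented_congruent_iff)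

lemma shape_dist_eq_orbit_distance:
  "shape_dist m (shape_class q) (shape_class q') = orbit_distance (shape_map m q) (shape_map m q')"
proof -
  have mem: "x \<in> shape_class q \<longleftrightarrow> shape_map m q = shape_map m x" for x q
    by (simp add: shape_class_def shape_rel_def oriented_congruent_iff)
  obtain q'' where "shape_map m q' = shape_map m q''"
    "mass_norm m (q - q'') = orbit_distance (shape_map m q) (shape_map m q')"
    using orbit_distance_attained[of q' q] oriented_congruent_iff by metis
  then have "orbit_distance (shape_map m q) (shape_map m q')
      \<in> (\<lambda>(x, x'). mass_norm m (x - x')) ` (shape_class q \<times> shape_class q')"
    by (intro image_eqI[of _ _ "(q, q'')"]) (simp_all add: mem)
  then have "(INF (x, x') \<in> shape_class q \<times> shape_class q'. mass_norm m (x - x')) =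
      orbit_distance (shape_map m q) (shape_map m q')"
  proof (rule cInf_eq_minimum)
    fix d assume "d \<in> (\<lambda>(x, x'). mass_norm m (x - x')) ` (shape_class q \<times> shape_class q')"
    then obtain x x' where "shape_map m q = shape_map m x" "shape_map m q' = shape_map m x'"
      "d = mass_norm m (x - x')"
      by (auto simp: mem)
    then show "orbit_distance (shape_map m q) (shape_map m q') \<le> d"
      by (simp only: orbit_distance_le_mass_norm)
  qed
  then show ?thesis by (simp add: shape_dist_def shape_class_in_shape_space)
qed

lemma shape_space_eq: "shape_space = range shape_class"
  by (auto simp: shape_space_def shape_class_def quotient_def)

text \<open>
  For the triangle inequality, a representative of the second class is chosen nearest to the first
  triangle, and then a representative of the third class nearest to that one.
\<close>

lemma Metric_space_shape_space: "Metric_space shape_space (shape_dist m)"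
proof
  fix A B C
  show "0 \<le> shape_dist m A B"
  proof (cases "A \<in> shape_space \<and> B \<in> shape_space")
    case True
    then show ?thesis by (auto simp: shape_space_eq shape_dist_eq_orbit_distance orbit_distance_nonneg)
  qed (auto simp: shape_dist_def)
  show "shape_dist m A B = shape_dist m B A"
  proof (cases "A \<in> shape_space \<and> B \<in> shape_space")
    case True
    then show ?thesis by (auto simp: shape_space_eq shape_dist_eq_orbit_distance orbit_distance_commute)
  qed (auto simp: shape_dist_def)
  assume A: "A \<in> shape_space" "B \<in> shape_space"
  then obtain a b where "A = shape_class a" "B = shape_class b"
    by (auto simp: shape_space_eq)
  then show "shape_dist m A B = 0 \<longleftrightarrow> A = B"
    by (simp add: shape_dist_eq_orbit_distance orbit_distance_eq_0_iff shape_class_eq_iff)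
  assume "C \<in> shape_space"
  with A obtain a b c where ABC: "A = shape_class a" "B = shape_class b" "C = shape_class c"
    by (auto simp: shape_space_eq)
  obtain b' where b': "shape_map m b = shape_map m b'"
    "mass_norm m (a - b') = orbit_distance (shape_map m a) (shape_map m b)"
    using orbit_distance_attained[of b a] oriented_congruent_iff by metis
  obtain c' where c': "shape_map m c = shape_map m c'"
    "mass_norm m (b' - c') = orbit_distance (shape_map m b) (shape_map m c)"
    using orbit_distance_attained[of c b'] oriented_congruent_iff b'(1) by metis
  have "orbit_distance (shape_map m a) (shape_map m c) \<le> mass_norm m ((a - b') + (b' - c'))"
    using orbit_distance_le_mass_norm[of a c'] c' by simp
  also have "\<dots> \<le> orbit_distance (shape_map m a) (shape_map m b)
      + orbit_distance (shape_map m b) (shape_map m c)"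
    using mass_norm_triangle[of "a - b'" "b' - c'"] b' c' by simp
  finally show "shape_dist m A C \<le> shape_dist m A B + shape_dist m B C"
    by (simp add: ABC shape_dist_eq_orbit_distance)
qed

section \<open>Topology of shape space\<close>

lemma surj_shape_map: "surj (shape_map m)"
proof -
  \<comment> \<open>By translation the second vertex may be put at the origin, and \<open>Z\<close> fixes the other two.\<close>
  have "\<exists>q. \<pi>_tr m q = Z" for Z
  proof
    define x where "x = Z $ 1 / of_real (\<mu>\<^sub>1 m)"
    have "\<mu>\<^sub>1 m \<noteq> 0" "\<mu>\<^sub>2 m \<noteq> 0"
      using \<mu>\<^sub>1_characterization[of m] \<mu>\<^sub>2_characterization[of m] mass_pos by auto
    then show "\<pi>_tr m (vector [x, 0,
        Z $ 2 / of_real (\<mu>\<^sub>2 m) + of_real (m $ 1) * x / of_real (m $ 1 + m $ 2)]) = Z"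
      by (simp add: \<pi>_tr_def vec_eq_iff forall_2 x_def)
  qed
  then have "surj (\<pi>_tr m)" by (metis surjI)
  then show ?thesis unfolding shape_map_def by (intro comp_surj surj_Pi_rot)
qed

lemma continuous_shape_map: "continuous_on UNIV (shape_map m)"
proof -
  have "continuous_on UNIV (\<lambda>q. shape_map m q $ i)" for i
    using exhaust_3[of i] mass_sum_nonzero(1)
    by (elim disjE; simp only: shape_map_def \<pi>_rot_def \<pi>_tr_def comp_apply vector_2 vector_3;
        intro continuous_intros) auto
  then have "continuous_on UNIV (\<lambda>q. \<chi> i. shape_map m q $ i)"
    by (rule continuous_on_vec_lambda)
  then show ?thesis by simp
qed

text \<open>
  A point near \<open>shape_map m q\<close> is the image of some triangle. A representative of its class at
  minimal distance from \<open>q\<close> is close to \<open>q\<close>, by the bound \<open>orbit_distance_le\<close>, so it stays inside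
  any given neighbourhood of \<open>q\<close>.
\<close>

lemma open_map_shape_map: "open_map euclidean euclidean (shape_map m)"
  unfolding open_map_def open_openin[symmetric]
proof (intro allI impI)
  fix U :: "triangle set" assume U: "open U"
  obtain k where k: "k > 0" "\<And>v. norm v \<le> k * mass_norm m v"
    using mass_norm_dominates_norm by blast
  show "open (shape_map m ` U)"
    unfolding open_dist
  proof (intro ballI)
    fix w assume "w \<in> shape_map m ` U"
    then obtain q where q: "q \<in> U" "w = shape_map m q" by auto
    obtain e where e: "e > 0" "\<And>q'. dist q' q < e \<Longrightarrow> q' \<in> U"
      using U q unfolding open_dist by metis
    show "\<exists>\<delta>>0. \<forall>w'. dist w' w < \<delta> \<longrightarrow> w' \<in> shape_map m ` U"
    proof (intro exI conjI allI impI)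
      show "(e / k)\<^sup>2 / 2 > 0" using e k by simp
      fix w' assume w': "dist w' w < (e / k)\<^sup>2 / 2"
      obtain p where "w' = shape_map m p" using surj_shape_map by (metis surjD)
      then obtain q' where q': "w' = shape_map m q'" "mass_norm m (q - q') = orbit_distance w w'"
        using orbit_distance_attained[of p q] oriented_congruent_iff q by metis
      have "(orbit_distance w w')\<^sup>2 < (e / k)\<^sup>2"
        using orbit_distance_le[of w w'] w' by (simp add: dist_norm norm_minus_commute)
      then have "orbit_distance w w' < e / k" by (rule power2_less_imp_less) (use e k in simp)
      then have "k * orbit_distance w w' < e" using k by (simp add: field_simps)
      with k(2)[of "q - q'"] q' have "dist q' q < e" by (simp add: dist_norm norm_minus_commute)
      with e q' show "w' \<in> shape_map m ` U" by auto
    qed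
  qed
qed

definition shape_coordinates :: "triangle set \<Rightarrow> real^3" where
  "shape_coordinates A = shape_map m (SOME q. A = shape_class q)"

lemma shape_coordinates: "shape_coordinates (shape_class q) = shape_map m q"
  unfolding shape_coordinates_def
  by (rule someI2[of _ q]) (simp_all add: shape_class_eq_iff)

text \<open>
  Under the bijection induced by the shape map, the quotient metric becomes the orbit distance on
  \<open>real^3\<close>; the two comparison bounds say that it has the same convergent sequences as the Euclidean
  distance.
\<close>

lemma homeomorphic_shape_coordinates:
  "homeomorphic_map (shape_topology m) euclidean shape_coordinates"
proof -
  interpret Metric_space shape_space "shape_dist m" by (rule Metric_space_shape_space)
  define g where "g w = shape_class (inv (shape_map m) w)" for w
  have inv: "shape_map m (inv (shape_map m) w) = w" for w
    by (rule surj_f_inv_f[OF surj_shape_map])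
  have dist_g: "shape_dist m (g w) (g w') = orbit_distance w w'" for w w'
    by (simp add: g_def shape_dist_eq_orbit_distance inv)
  have "continuous_map mtopology Met_TC.mtopology shape_coordinates"
    unfolding metric_continuous_map[OF Met_TC.Metric_space_axioms]
  proof (intro conjI ballI allI impI)
    fix A and e :: real assume "A \<in> shape_space" and e: "e > 0"
    then obtain a where a: "A = shape_class a" by (auto simp: shape_space_eq)
    define r where "r = 2 * norm (shape_map m a)"
    define f where "f = e / 2"
    have f: "f > 0" using e by (simp add: f_def)
    \<comment> \<open>With \<open>x\<close> the Euclidean distance, the bound is \<open>x\<^sup>2 / (r + x) \<le> orbit_distance\<^sup>2\<close>, whose left
      side increases in \<open>x\<close>; \<open>\<delta>\<^sup>2\<close> is its value at \<open>x = f\<close>. Taking \<open>f = e / 2\<close> turns the resulting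
      weak inequality \<open>x \<le> f\<close> into the strict one.\<close>
    define \<delta> where "\<delta> = sqrt (f\<^sup>2 / (r + f))"
    have r: "r \<ge> 0" by (simp add: r_def)
    show "\<exists>\<delta>>0. \<forall>B. B \<in> shape_space \<and> shape_dist m A B < \<delta> \<longrightarrow>
        dist (shape_coordinates A) (shape_coordinates B) < e"
    proof (intro exI[of _ \<delta>] conjI allI impI)
      show "\<delta> > 0" using f r by (simp add: \<delta>_def)
      fix B assume B: "B \<in> shape_space \<and> shape_dist m A B < \<delta>"
      then obtain b where b: "B = shape_class b" by (auto simp: shape_space_eq)
      define x where "x = norm (shape_map m a - shape_map m b)"
      have "orbit_distance (shape_map m a) (shape_map m b) < \<delta>"
        using B by (simp add: a b shape_dist_eq_orbit_distance)
      then have "(orbit_distance (shape_map m a) (shape_map m b))\<^sup>2 < \<delta>\<^sup>2"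
        by (intro power_strict_mono) (auto simp: orbit_distance_nonneg)
      then have close: "(orbit_distance (shape_map m a) (shape_map m b))\<^sup>2 < f\<^sup>2 / (r + f)"
        using f r by (simp add: \<delta>_def)
      have x: "0 \<le> x" by (simp add: x_def)
      have "x\<^sup>2 \<le> (orbit_distance (shape_map m a) (shape_map m b))\<^sup>2
          * (norm (shape_map m a) + norm (shape_map m b))"
        unfolding x_def by (rule orbit_distance_ge)
      also have "\<dots> \<le> f\<^sup>2 / (r + f) * (r + x)"
        using close norm_triangle_ineq2[of "shape_map m b" "shape_map m a"] r f
        by (intro mult_mono) (auto simp: r_def x_def norm_minus_commute)
      finally have "x\<^sup>2 * (r + f) \<le> f\<^sup>2 * (r + x)"
        using f r by (simp add: field_simps add_pos_nonneg)
      \<comment> \<open>Monotonicity of \<open>x\<^sup>2 / (r + x)\<close>, with denominators cleared.\<close>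
      then have "(x - f) * (r * (x + f) + x * f) \<le> 0"
        by (simp add: power2_eq_square algebra_simps)
      moreover have "r * (x + f) + x * f > 0" if "x > f"
        using that f r x by (intro add_nonneg_pos mult_nonneg_nonneg mult_pos_pos) auto
      ultimately have "x \<le> f"
        by (metis mult_pos_pos diff_gt_0_iff_gt not_le)
      then show "dist (shape_coordinates A) (shape_coordinates B) < e"
        using e by (simp add: a b shape_coordinates dist_norm x_def f_def)
    qed
  qed simp
  moreover have "continuous_map Met_TC.mtopology mtopology g"
    unfolding Met_TC.metric_continuous_map[OF Metric_space_shape_space]
  proof (intro conjI ballI allI impI)
    show "g ` UNIV \<subseteq> shape_space" by (auto simp: g_def shape_class_in_shape_space)
    fix w and e :: real assume e: "e > 0"
    show "\<exists>\<delta>>0. \<forall>w'. w' \<in> UNIV \<and> dist w w' < \<delta> \<longrightarrow> shape_dist m (g w) (g w') < e"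
    proof (intro exI[of _ "e\<^sup>2 / 2"] conjI allI impI)
      show "e\<^sup>2 / 2 > 0" using e by simp
      fix w' assume "w' \<in> UNIV \<and> dist w w' < e\<^sup>2 / 2"
      then have "(orbit_distance w w')\<^sup>2 < e\<^sup>2"
        using orbit_distance_le[of w w'] by (simp add: dist_norm)
      then show "shape_dist m (g w) (g w') < e"
        unfolding dist_g by (rule power2_less_imp_less) (use e in simp)
    qed
  qed
  moreover have "g (shape_coordinates A) = A" if A: "A \<in> shape_space" for A
  proof -
    obtain q where "A = shape_class q" using A by (auto simp: shape_space_eq)
    then show ?thesis by (simp add: shape_coordinates g_def shape_class_eq_iff inv)
  qed
  moreover have "shape_coordinates (g w) = w" for w
    by (simp add: g_def shape_coordinates inv)
  ultimately have "homeomorphic_maps (shape_topology m) euclidean shape_coordinates g"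
    by (simp add: homeomorphic_maps_def shape_topology_def)
  then show ?thesis by (auto simp: homeomorphic_map_maps)
qed

section \<open>Area, collinearity and reflections\<close>

text \<open>
  Both Jacobi coordinates contain a real multiple of the side \<open>u\<close> from the first to the second
  vertex. Since \<open>u * cnj u\<close> is real, the imaginary part of \<open>Z\<^sub>1 cnj Z\<^sub>2\<close> keeps only the cross product
  of \<open>u\<close> with the other side \<open>v\<close>.
\<close>

lemma shape_map_signed_area: "shape_map m q $ 3 = 2 * \<mu>\<^sub>1 m * \<mu>\<^sub>2 m * signed_area q"
proof -
  define s where "s = m $ 1 + m $ 2"
  define u v where "u = q $ 2 - q $ 1" and "v = q $ 3 - q $ 1"
  have s: "s \<noteq> 0" "of_real s \<noteq> (0 :: complex)"
    using mass_pos mass_sum_nonzero(1) by (simp_all add: s_def)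
  have "q $ 3 - (of_real (m $ 1) * q $ 1 + of_real (m $ 2) * q $ 2) / of_real s
      = v - of_real (m $ 2 / s) * u"
    using s unfolding u_def v_def by (simp add: field_simps) (simp add: s_def algebra_simps)
  moreover have "q $ 1 - q $ 2 = - u" by (simp add: u_def)
  ultimately have "shape_map m q $ 3 =
      Im (of_real (\<mu>\<^sub>1 m) * - u * cnj (of_real (\<mu>\<^sub>2 m) * (v - of_real (m $ 2 / s) * u)))"
    by (simp only: shape_map_def \<pi>_rot_def \<pi>_tr_def comp_apply vector_2 vector_3 s_def)
  also have "\<dots> = 2 * \<mu>\<^sub>1 m * \<mu>\<^sub>2 m * (Im (cnj u * v) / 2)"
    by (simp add: algebra_simps)
  finally show ?thesis by (simp add: signed_area_def u_def v_def)
qed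

lemma shape_map_conj: "shape_map m (vertexwise cnj q) = reflect3 (shape_map m q)"
proof -
  have "\<pi>_tr m (vertexwise cnj q) = (\<chi> i. cnj (\<pi>_tr m q $ i))"
    by (simp add: vec_eq_iff forall_2 \<pi>_tr_def vertexwise_def)
  then show ?thesis
    by (simp add: shape_map_def vec_eq_iff forall_3 \<pi>_rot_def reflect3_def)
qed

text \<open>
  An isometry preserves the inner products of the sides \<open>u\<close> and \<open>v\<close> issuing from the third vertex.
  The Jacobi coordinates are real combinations of \<open>u\<close> and \<open>v\<close>, so their norms and their real inner
  product are preserved. These determine \<open>w\<^sub>1\<close>, \<open>w\<^sub>2\<close> and the norm of \<open>w\<close>, hence \<open>w\<^sub>3\<close> up to sign.
\<close>

lemma shape_map_isometry:
  assumes "plane_isometry f"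
  shows "shape_map m (vertexwise f q) = shape_map m q \<or>
         shape_map m (vertexwise f q) = reflect3 (shape_map m q)"
proof -
  define s where "s = m $ 1 + m $ 2"
  have s: "of_real s \<noteq> (0 :: complex)" using mass_sum_nonzero(1) by (simp add: s_def)
  define u v where "u p = p $ 3 - p $ 1" and "v p = p $ 3 - p $ 2" for p :: triangle
  define \<alpha> \<beta> where "\<alpha> = m $ 1 / s" and "\<beta> = m $ 2 / s"
  have Z1: "\<pi>_tr m p $ 1 = \<mu>\<^sub>1 m *\<^sub>R (v p - u p)" for p
    by (simp add: \<pi>_tr_def scaleR_conv_of_real u_def v_def)
  have Z2: "\<pi>_tr m p $ 2 = \<mu>\<^sub>2 m *\<^sub>R (\<alpha> *\<^sub>R u p + \<beta> *\<^sub>R v p)" for p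
  proof -
    have "p $ 3 - (of_real (m $ 1) * p $ 1 + of_real (m $ 2) * p $ 2) / of_real s
        = \<alpha> *\<^sub>R u p + \<beta> *\<^sub>R v p"
      using s unfolding u_def v_def \<alpha>_def \<beta>_def scaleR_conv_of_real
      by (simp add: field_simps) (simp add: s_def algebra_simps)
    then show ?thesis
      by (simp only: \<pi>_tr_def vector_2 scaleR_conv_of_real s_def)
  qed
  have n1: "(cmod (\<pi>_tr m p $ 1))\<^sup>2 =
      (\<mu>\<^sub>1 m)\<^sup>2 * (v p \<bullet> v p - 2 * (u p \<bullet> v p) + u p \<bullet> u p)" for p
    unfolding Z1 power2_norm_eq_inner
    by (simp add: inner_simps inner_commute power2_eq_square algebra_simps)
  have n2: "(cmod (\<pi>_tr m p $ 2))\<^sup>2 =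
      (\<mu>\<^sub>2 m)\<^sup>2 * (\<alpha>\<^sup>2 * (u p \<bullet> u p) + 2 * \<alpha> * \<beta> * (u p \<bullet> v p) + \<beta>\<^sup>2 * (v p \<bullet> v p))" for p
    unfolding Z2 power2_norm_eq_inner
    by (simp add: inner_simps inner_commute power2_eq_square algebra_simps)
  have n12: "Re (\<pi>_tr m p $ 1 * cnj (\<pi>_tr m p $ 2)) =
      \<mu>\<^sub>1 m * \<mu>\<^sub>2 m * (\<alpha> * (u p \<bullet> v p) + \<beta> * (v p \<bullet> v p) - \<alpha> * (u p \<bullet> u p) - \<beta> * (u p \<bullet> v p))" for p
  proof -
    have "Re (a * cnj b) = a \<bullet> b" for a b by (simp add: inner_complex_def)
    then show ?thesis
      unfolding Z1 Z2 by (simp add: inner_simps inner_commute algebra_simps)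
  qed
  let ?p = "vertexwise f q"
  have iso: "cmod (f x - f y) = cmod (x - y)" for x y
    using assms by (simp add: plane_isometry_def dist_norm)
  have uu: "u ?p \<bullet> u ?p = u q \<bullet> u q" and vv: "v ?p \<bullet> v ?p = v q \<bullet> v q"
    by (simp_all add: u_def v_def vertexwise_def iso flip: power2_norm_eq_inner)
  have uv: "u ?p \<bullet> v ?p = u q \<bullet> v q"
  proof -
    have "u p \<bullet> v p = (u p \<bullet> u p + v p \<bullet> v p - (cmod (p $ 2 - p $ 1))\<^sup>2) / 2" for p
    proof -
      have "p $ 2 - p $ 1 = u p - v p" by (simp add: u_def v_def)
      then show ?thesis
        unfolding power2_norm_eq_inner by (simp add: inner_simps inner_commute)
    qed
    from this[of ?p] this[of q] show ?thesis
      unfolding uu vv by (simp add: vertexwise_def iso)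
  qed
  define w where "w = shape_map m q"
  define w' where "w' = shape_map m ?p"
  have norms: "(cmod (\<pi>_tr m ?p $ 1))\<^sup>2 = (cmod (\<pi>_tr m q $ 1))\<^sup>2"
    "(cmod (\<pi>_tr m ?p $ 2))\<^sup>2 = (cmod (\<pi>_tr m q $ 2))\<^sup>2"
    unfolding n1 n2 uu vv uv by simp_all
  have w1: "w' $ 1 = w $ 1"
    unfolding w_def w'_def shape_map_def comp_apply \<pi>_rot_def vector_3 norms ..
  have w2: "w' $ 2 = w $ 2"
    unfolding w_def w'_def shape_map_def comp_apply \<pi>_rot_def vector_3 n12 uu vv uv ..
  have "norm w' = norm w"
    unfolding w_def w'_def shape_map_def comp_apply norm_Pi_rot norm_sq_complex2 norms ..
  then have "(w' $ 3)\<^sup>2 = (w $ 3)\<^sup>2"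
    using norm_sq_real3[of w] norm_sq_real3[of w'] w1 w2 by simp
  then have "w' $ 3 = w $ 3 \<or> w' $ 3 = - w $ 3"
    by (simp add: power2_eq_iff)
  with w1 w2 show ?thesis
    unfolding w_def[symmetric] w'_def[symmetric]
    by (auto simp: vec_eq_iff forall_3 reflect3_def)
qed

text \<open>
  For the converse direction, complex conjugation realises the reflection \<open>reflect3\<close>, so a
  rigid motion followed by conjugation serves in the reflected case.
\<close>

lemma congruent_triangles_iff:
  "congruent_triangles q q' \<longleftrightarrow>
     shape_map m q = shape_map m q' \<or> shape_map m q = reflect3 (shape_map m q')"
proof
  have reflect_twice: "reflect3 (reflect3 w) = w" for w
    by (simp add: reflect3_def vec_eq_iff forall_3)
  assume "congruent_triangles q q'"
  then show "shape_map m q = shape_map m q' \<or> shape_map m q = reflect3 (shape_map m q')"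
    unfolding congruent_triangles_def using shape_map_isometry reflect_twice by metis
next
  have rigid: "plane_isometry g" if "g \<in> rigid_motions" for g
    using that
    by (auto simp: rigid_motions_def plane_isometry_def dist_norm norm_mult simp flip: right_diff_distrib)
  assume "shape_map m q = shape_map m q' \<or> shape_map m q = reflect3 (shape_map m q')"
  then show "congruent_triangles q q'"
  proof
    assume "shape_map m q = shape_map m q'"
    then show ?thesis
      using rigid unfolding congruent_triangles_def
      by (auto simp: oriented_congruent_def simp flip: oriented_congruent_iff)
  next
    assume "shape_map m q = reflect3 (shape_map m q')"
    then have "oriented_congruent q (vertexwise cnj q')"
      by (simp add: oriented_congruent_iff shape_map_conj)
    then obtain g where g: "g \<in> rigid_motions" "vertexwise g q = vertexwise cnj q'"
      by (auto simp: oriented_congruent_def)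
    have "vertexwise (cnj \<circ> g) q = q'"
      unfolding vertexwise_comp[symmetric] g by (simp add: vertexwise_def)
    moreover have "plane_isometry (cnj \<circ> g)"
      using rigid[OF g(1)]
      by (simp add: plane_isometry_def dist_norm flip: complex_cnj_diff)
    ultimately show ?thesis unfolding congruent_triangles_def by blast
  qed
qed

lemma shape_map_triple_collisions: "shape_map m ` triple_collisions = {0}"
proof -
  have "shape_map m (vector [c, c, c]) = 0" for c
  proof -
    have "vector [c, c, c] = vertexwise (\<lambda>z. 0 * z + c) 0"
      by (simp add: vertexwise_def vec_eq_iff forall_3)
    then have "\<pi>_tr m (vector [c, c, c]) = 0"
      by (simp only: Pi_tr_affine) (simp add: vec_eq_iff)
    then show ?thesis
      by (simp add: shape_map_def \<pi>_rot_def vec_eq_iff forall_3)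
  qed
  moreover have range: "triple_collisions = range (\<lambda>c. vector [c, c, c])"
    by (auto simp: triple_collisions_def)
  ultimately show ?thesis unfolding range image_image by simp
qed

lemma norm_shape_map_centered:
  assumes "center_of_mass m q = 0"
  shows "norm (shape_map m q) = (mass_norm m q)\<^sup>2 / 2"
  using assms mass_norm_Jacobi[of q] by (simp add: shape_map_def norm_Pi_rot)

end

theorem theorem1:
  fixes m :: "real^3"
  assumes "m $ 1 > 0" and "m $ 2 > 0" and "m $ 3 > 0"
  shows
    "equiv UNIV shape_rel \<and>
     Metric_space shape_space (shape_dist m) \<and>
     shape_topology m homeomorphic_space (euclidean :: (real^3) topology) \<and>
     quotient_map euclidean euclidean (shape_map m) \<and>
     (\<exists>h. (\<forall>q. h (shape_class q) = shape_map m q) \<and>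
          homeomorphic_map (shape_topology m) euclidean h) \<and>
     (\<forall>q q'. oriented_congruent q q' \<longleftrightarrow> shape_map m q = shape_map m q') \<and>
     surj (shape_map m) \<and>
     shape_map m ` triple_collisions = {0} \<and>
     (\<exists>\<kappa>. \<kappa> \<noteq> 0 \<and> (\<forall>q. shape_map m q $ 3 = \<kappa> * signed_area q)) \<and>
     (\<forall>q. collinear {q $ 1, q $ 2, q $ 3} \<longleftrightarrow> shape_map m q $ 3 = 0) \<and>
     (\<forall>q q'. congruent_triangles q q' \<longleftrightarrow>
        shape_map m q = shape_map m q' \<or> shape_map m q = reflect3 (shape_map m q')) \<and>
     (\<forall>q. of_real (m $ 1) * q $ 1 + of_real (m $ 2) * q $ 2 + of_real (m $ 3) * q $ 3 = 0 \<longrightarrow>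
        (shape_map m q $ 1)\<^sup>2 + (shape_map m q $ 2)\<^sup>2 + (shape_map m q $ 3)\<^sup>2 =
        ((m $ 1 * (cmod (q $ 1))\<^sup>2 + m $ 2 * (cmod (q $ 2))\<^sup>2 + m $ 3 * (cmod (q $ 3))\<^sup>2) / 2)\<^sup>2)"
proof -
  interpret positive_masses m using assms by unfold_locales
  define \<kappa> where "\<kappa> = 2 * \<mu>\<^sub>1 m * \<mu>\<^sub>2 m"
  have \<kappa>: "\<kappa> \<noteq> 0"
    using \<mu>\<^sub>1_characterization(1)[of m] \<mu>\<^sub>2_characterization(1)[of m] assms by (simp add: \<kappa>_def)
  have area: "shape_map m q $ 3 = \<kappa> * signed_area q" for q
    unfolding \<kappa>_def by (rule shape_map_signed_area)
  have quotient: "quotient_map euclidean euclidean (shape_map m)"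
    using continuous_shape_map open_map_shape_map surj_shape_map
    by (intro continuous_open_imp_quotient_map) auto
  show ?thesis
  proof (intro conjI allI impI)
    show "shape_topology m homeomorphic_space (euclidean :: (real^3) topology)"
      by (rule homeomorphic_map_imp_homeomorphic_space[OF homeomorphic_shape_coordinates])
    show "\<exists>h. (\<forall>q. h (shape_class q) = shape_map m q) \<and>
        homeomorphic_map (shape_topology m) euclidean h"
      using shape_coordinates homeomorphic_shape_coordinates by blast
    show "\<exists>\<kappa>. \<kappa> \<noteq> 0 \<and> (\<forall>q. shape_map m q $ 3 = \<kappa> * signed_area q)"
      using \<kappa> area by blast
    fix q
    show "collinear {q $ 1, q $ 2, q $ 3} \<longleftrightarrow> shape_map m q $ 3 = 0"
      using \<kappa> by (simp add: area collinear_iff_signed_area)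
    assume "of_real (m $ 1) * q $ 1 + of_real (m $ 2) * q $ 2 + of_real (m $ 3) * q $ 3 = 0"
    then have "center_of_mass m q = 0" by (simp add: center_of_mass_def)
    then show "(shape_map m q $ 1)\<^sup>2 + (shape_map m q $ 2)\<^sup>2 + (shape_map m q $ 3)\<^sup>2 =
        ((m $ 1 * (cmod (q $ 1))\<^sup>2 + m $ 2 * (cmod (q $ 2))\<^sup>2 + m $ 3 * (cmod (q $ 3))\<^sup>2) / 2)\<^sup>2"
      unfolding norm_sq_real3[symmetric] mass_norm_sq[symmetric]
      by (simp add: norm_shape_map_centered)
  qed (fact equiv_shape_rel Metric_space_shape_space quotient oriented_congruent_iff
      surj_shape_map shape_map_triple_collisions congruent_triangles_iff)+
qed

end
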